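(* Let $n\ge1$. For all $\pi\in\mathcal S_n(321)$, \[\operatorname{sgn}(\rho_{\mathcal S}(\pi))=\operatorname{sgn}(\mathrm{LK}_{\mathcal S}(\pi))=\begin{cases}\operatorname{sgn}(\pi)&\text{if $n$ is odd,}\\-\operatorname{sgn}(\pi)&\text{if $n$ is even.}\end{cases}\]
   Context: $\operatorname{sgn}(\pi)=(-1)^{\mathrm{inv}(\pi)}$, where $\mathrm{inv}(\pi)=|\{(i,i'):i<i',\ \pi(i)>\pi(i')\}|$. $\mathcal S_n(321)$ is the set of permutations $\pi$ of $\{1,\dots,n\}$ that are $321$-avoiding: there are no $i<j<k$ with $\pi(i)>\pi(j)>\pi(k)$. $\mathbf A^{n-1}$ is the poset of intervals $\{[i,j]:1\le i\le j\le n-1\}$ ordered by inclusion, and $\mathcal A(\mathbf A^{n-1})$ is its set of antichains. Antichain rowmotion $\rho_{\mathcal A}$ sends an antichain $A$ to the set of minimal elements of the complement of the order ideal generated by $A$; it is a bijection. The map $\mathrm{Exc}:\mathcal S_n(321)\to\mathcal A(\mathbf A^{n-1})$, $\mathrm{Exc}(\pi)=\{[i,\pi(i)-1]:\pi(i)>i\}$, is a bijection. Rowmotion on $321$-avoiding permutations is $\rho_{\mathcal S}=\mathrm{Exc}^{-1}\circ\rho_{\mathcal A}\circ\mathrm{Exc}$. Dyck paths: $\mathcal D_n$ is the set of words with $n$ letters $\mathtt u$ and $n$ letters $\mathtt d$ such that every prefix has at least as many $\mathtt u$'s as $\mathtt d$'s. A consecutive pair $\mathtt{ud}$ is a peak and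 a consecutive pair $\mathtt{du}$ is a valley. Words can be drawn as lattice paths from $(0,0)$ to $(n,n)$ in two ways: with $\mathtt u=(0,1),\mathtt d=(1,0)$ (path weakly above $y=x$), or with $\mathtt u=(1,0),\mathtt d=(0,1)$ (path weakly below $y=x$). In either drawing, a peak or valley consists of one horizontal step and one vertical step; it is said to occur at the cell $(i,j)$ if the horizontal step is in column $i$ (goes from $x=i-1$ to $x=i$) and the vertical step is in row $j$ (goes from $y=j-1$ to $y=j$). For $\pi\in\mathcal S_n(321)$, $E_p(\pi)\in\mathcal D_n$ is the path drawn above the diagonal whose peaks occur exactly at the cells $(i,\pi(i))$ with $\pi(i)\ge i$, and $D_v(\pi)\in\mathcal D_n$ is the path drawn below the diagonal whose valleys occur exactly at the cells $(i,\pi(i))$ with $\pi(i)<i$. Both $E_p,D_v:\mathcal S_n(321)\to\mathcal D_n$ are bijections. The Lalanne--Kreweras involution on $\mathcal D_n$ is $\mathrm{LK}=D_v\circ E_p^{-1}$, and $\mathrm{LK}_{\mathcal S}=E_p^{-1}\circ\mathrm{LK}\circ E_p:\mathcal S_n(321)\to\mathcal S_n(321)$. *)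

theory Defs
  imports "HOL-Combinatorics.Permutations"
begin

definition inversions :: "nat \<Rightarrow> (nat \<Rightarrow> nat) \<Rightarrow> (nat \<times> nat) set" where
  "inversions n p = {(i, i'). i \<in> {1..n} \<and> i' \<in> {1..n} \<and> i < i' \<and> p i > p i'}"

definition perm_sgn :: "nat \<Rightarrow> (nat \<Rightarrow> nat) \<Rightarrow> int" where
  "perm_sgn n p = (-1) ^ card (inversions n p)"

definition avoids_321 :: "nat \<Rightarrow> (nat \<Rightarrow> nat) \<Rightarrow> bool" where
  "avoids_321 n p \<longleftrightarrow>
     \<not> (\<exists>i\<in>{1..n}. \<exists>j\<in>{1..n}. \<exists>k\<in>{1..n}. i < j \<and> j < k \<and> p i > p j \<and> p j > p k)"

definition S321 :: "nat \<Rightarrow> (nat \<Rightarrow> nat) set" where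
  "S321 n = {p. p permutes {1..n} \<and> avoids_321 n p}"

text \<open>A poset is given by a carrier \<open>P\<close> in a type of class \<open>order\<close>.\<close>

definition order_ideal_gen :: "'a::order set \<Rightarrow> 'a set \<Rightarrow> 'a set" where
  "order_ideal_gen P A = {x \<in> P. \<exists>a\<in>A. x \<le> a}"

definition minimal_elements :: "'a::order set \<Rightarrow> 'a set" where
  "minimal_elements C = {x \<in> C. \<not> (\<exists>y\<in>C. y < x)}"

definition antichain_rowmotion :: "'a::order set \<Rightarrow> 'a set \<Rightarrow> 'a set" where
  "antichain_rowmotion P A = minimal_elements (P - order_ideal_gen P A)"

text \<open>An interval $[i,j]$ is the set \<open>{i..j}\<close>, so inclusion is the order \<open>\<le>\<close> of type
  \<^typ>\<open>nat set\<close>.\<close>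

definition interval_poset :: "nat \<Rightarrow> nat set set" where
  "interval_poset m = {{i..j} | i j. 1 \<le> i \<and> i \<le> j \<and> j \<le> m}"

definition Exc :: "nat \<Rightarrow> (nat \<Rightarrow> nat) \<Rightarrow> nat set set" where
  "Exc n p = {{i..p i - 1} | i. i \<in> {1..n} \<and> p i > i}"

definition rho_S :: "nat \<Rightarrow> (nat \<Rightarrow> nat) \<Rightarrow> (nat \<Rightarrow> nat)" where
  "rho_S n = the_inv_into (S321 n) (Exc n) \<circ> antichain_rowmotion (interval_poset (n - 1)) \<circ> Exc n"

datatype letter = Up | Down

definition dyck :: "nat \<Rightarrow> letter list set" where
  "dyck n = {w. count_list w Up = n \<and> count_list w Down = n \<and>
     (\<forall>k\<le>length w. count_list (take k w) Down \<le> count_list (take k w) Up)}"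

text \<open>The step at (0-based) position \<open>t\<close> of a word starts at the point whose two coordinates are
  the numbers of letters of either kind in \<open>take t w\<close>; so if it is horizontal (vertical), its
  column (row) is one more than the number of earlier letters of its own kind.\<close>

text \<open>Cells of the peaks \<open>Up Down\<close> in the drawing above the diagonal, where \<open>Up\<close> is vertical and
  \<open>Down\<close> is horizontal.\<close>

definition peak_cells_above :: "letter list \<Rightarrow> (nat \<times> nat) set" where
  "peak_cells_above w = {(i, j). \<exists>t. Suc t < length w \<and> w ! t = Up \<and> w ! Suc t = Down \<and>
     i = Suc (count_list (take (Suc t) w) Down) \<and> j = Suc (count_list (take t w) Up)}"

text \<open>Cells of the valleys \<open>Down Up\<close> in the drawing below the diagonal, where \<open>Up\<close> is horizontal
  and \<open>Down\<close> is vertical.\<close>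

definition valley_cells_below :: "letter list \<Rightarrow> (nat \<times> nat) set" where
  "valley_cells_below w = {(i, j). \<exists>t. Suc t < length w \<and> w ! t = Down \<and> w ! Suc t = Up \<and>
     i = Suc (count_list (take (Suc t) w) Up) \<and> j = Suc (count_list (take t w) Down)}"

text \<open>A Dyck path is determined by its peak cells and also by its valley cells, and for \<open>p \<in> S321 n\<close>
  the sets below do arise in this way; for other \<open>p\<close> the descriptions may fail to denote.\<close>

definition E_p :: "nat \<Rightarrow> (nat \<Rightarrow> nat) \<Rightarrow> letter list" where
  "E_p n p = (THE w. w \<in> dyck n \<and> peak_cells_above w = {(i, p i) | i. i \<in> {1..n} \<and> p i \<ge> i})"

definition D_v :: "nat \<Rightarrow> (nat \<Rightarrow> nat) \<Rightarrow> letter list" where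
  "D_v n p = (THE w. w \<in> dyck n \<and> valley_cells_below w = {(i, p i) | i. i \<in> {1..n} \<and> p i < i})"

definition LK :: "nat \<Rightarrow> letter list \<Rightarrow> letter list" where
  "LK n = D_v n \<circ> the_inv_into (S321 n) (E_p n)"

definition LK_S :: "nat \<Rightarrow> (nat \<Rightarrow> nat) \<Rightarrow> (nat \<Rightarrow> nat)" where
  "LK_S n = the_inv_into (S321 n) (E_p n) \<circ> LK n \<circ> E_p n"

end

theory Submission
  imports Defs
begin

text \<open>
  Encode a Dyck path by its height function \<open>c\<close>, where \<open>c i\<close> is the number of letters \<open>Up\<close>
  before the \<open>i\<close>-th letter \<open>Down\<close>. Above the diagonal its peaks are the cells \<open>(i, c i)\<close> with
  \<open>c (i - 1) < c i\<close>, and below the diagonal its valleys are the cells \<open>(c i + 1, i)\<close> with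
  \<open>c i < c (i + 1)\<close>. In a 321-avoiding permutation an inversion always starts at an excedance, and
  \<open>i\<close> starts exactly \<open>\<pi> i - i\<close> of them, so the inversion number is the sum of \<open>\<pi> i - i\<close> over the
  excedances, or equally of \<open>i - \<pi> i\<close> over the antiexcedances. For every path the total distance of its
  peaks and valleys from the diagonal telescopes modulo 2 to \<open>n - 1\<close>. The peaks of the path given
  by the prefix maxima of \<open>\<pi>\<close> are the weak excedances of \<open>\<pi>\<close>. Both maps relate the peaks to
  the valleys of one path: the transposed valleys of the path of \<open>\<pi>\<close> are the excedances of the
  rowmotion of \<open>\<pi>\<close>, and the path whose valleys are the antiexcedances of \<open>\<pi>\<close> has the weak
  excedances of the Lalanne--Kreweras image of \<open>\<pi>\<close> as its peaks.
\<close>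

section \<open>Height functions\<close>

text \<open>The last conjunct is the Dyck condition. Values beyond \<open>n\<close> are left free,
  so paths are compared only up to \<open>n\<close>.\<close>

definition height_fun :: "nat \<Rightarrow> (nat \<Rightarrow> nat) \<Rightarrow> bool" where
  "height_fun n c \<longleftrightarrow> c 0 = 0 \<and> c n = n \<and> (\<forall>i<n. c i \<le> c (Suc i)) \<and> (\<forall>i\<le>n. i \<le> c i)"

definition peak_pairs :: "nat \<Rightarrow> (nat \<Rightarrow> nat) \<Rightarrow> (nat \<times> nat) set" where
  "peak_pairs n c = {(i, c i) | i. i \<in> {1..n} \<and> c (i - 1) < c i}"

definition valley_pairs :: "nat \<Rightarrow> (nat \<Rightarrow> nat) \<Rightarrow> (nat \<times> nat) set" where
  "valley_pairs n c = {(Suc (c i), i) | i. i \<in> {1..<n} \<and> c i < c (Suc i)}"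

lemma height_fun_mono:
  assumes "height_fun n c" "i \<le> j" "j \<le> n"
  shows "c i \<le> c j"
  using assms(2,3)
proof (induction j rule: dec_induct)
  case (step k)
  then show ?case
    using assms(1) unfolding height_fun_def by (meson Suc_leD Suc_le_lessD le_trans)
qed simp

lemma height_fun_le: "height_fun n c \<Longrightarrow> i \<le> n \<Longrightarrow> c i \<le> n"
  using height_fun_mono[of n c i n] by (simp add: height_fun_def)

lemma height_fun_ge: "height_fun n c \<Longrightarrow> i \<le> n \<Longrightarrow> i \<le> c i"
  by (simp add: height_fun_def)

text \<open>Upward from \<open>c 0 = 0\<close>: a pair in column \<open>Suc i\<close> records
  \<open>c (Suc i)\<close>, and without one the height stays \<open>c i\<close>.\<close>

lemma peak_pairs_inj:
  assumes "height_fun n c" "height_fun n d" "peak_pairs n c = peak_pairs n d" "i \<le> n"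
  shows "c i = d i"
  using assms(4)
proof (induction i)
  case 0
  then show ?case using assms(1,2) by (simp add: height_fun_def)
next
  case (Suc i)
  have eq: "(Suc i, m) \<in> peak_pairs n c \<longleftrightarrow> (Suc i, m) \<in> peak_pairs n d" for m
    using assms(3) by simp
  have "c i \<le> c (Suc i)" "d i \<le> d (Suc i)"
    using Suc.prems assms(1,2) by (auto simp: height_fun_def)
  then show ?case
    using eq[of "c (Suc i)"] eq[of "d (Suc i)"] Suc unfolding peak_pairs_def by auto
qed

text \<open>Downward from \<open>c n = n\<close>: a pair in row \<open>i\<close> records
  \<open>c i\<close>, and without one \<open>c i = c (Suc i)\<close>. Rows start at 1, so index 0 is
  settled separately.\<close>

lemma valley_pairs_inj:
  assumes "height_fun n c" "height_fun n d" "valley_pairs n c = valley_pairs n d" "i \<le> n"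
  shows "c i = d i"
proof (cases "i = 0")
  case True
  then show ?thesis using assms(1,2) by (simp add: height_fun_def)
next
  case False
  from assms(4) have "i \<noteq> 0 \<longrightarrow> c i = d i"
  proof (induction i rule: inc_induct)
    case base
    then show ?case using assms(1,2) by (simp add: height_fun_def)
  next
    case (step i)
    have eq: "(m, i) \<in> valley_pairs n c \<longleftrightarrow> (m, i) \<in> valley_pairs n d" for m
      using assms(3) by simp
    have "c i \<le> c (Suc i)" "d i \<le> d (Suc i)"
      using step.hyps assms(1,2) by (auto simp: height_fun_def)
    then show ?case
      using eq[of "Suc (c i)"] eq[of "Suc (d i)"] step unfolding valley_pairs_def by auto
  qed
  with False show ?thesis by simp
qed

section \<open>Parity of the peak and valley sums\<close>

lemma finite_peak_pairs: "finite (peak_pairs n c)"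
proof -
  have "peak_pairs n c = (\<lambda>i. (i, c i)) ` {i \<in> {1..n}. c (i - 1) < c i}"
    unfolding peak_pairs_def by auto
  then show ?thesis by simp
qed

lemma peak_pairs_Suc:
  "peak_pairs (Suc n) c = peak_pairs n c \<union> (if c n < c (Suc n) then {(Suc n, c (Suc n))} else {})"
  unfolding peak_pairs_def by (auto simp: le_Suc_eq)

lemma valley_pairs_Suc:
  "valley_pairs (Suc n) c =
     valley_pairs n c \<union> (if 0 < n \<and> c n < c (Suc n) then {(Suc (c n), n)} else {})"
  unfolding valley_pairs_def by (auto simp: less_Suc_eq)

lemma finite_valley_pairs: "finite (valley_pairs n c)"
  by (induction n) (auto simp: valley_pairs_Suc, simp add: valley_pairs_def)

text \<open>Integer-valued, because the telescoping below does not assume the Dyck condition and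
  differences may be negative.\<close>

definition peak_sum :: "nat \<Rightarrow> (nat \<Rightarrow> nat) \<Rightarrow> int" where
  "peak_sum n c = (\<Sum>(i, j)\<in>peak_pairs n c. int j - int i)"

definition valley_sum :: "nat \<Rightarrow> (nat \<Rightarrow> nat) \<Rightarrow> int" where
  "valley_sum n c = (\<Sum>(i, j)\<in>valley_pairs n c. int i - int j)"

text \<open>The peak at height \<open>c (Suc i)\<close> and the valley before it contribute
  \<open>c (Suc i) + c i\<close> modulo 2, that is, the length of the ascent between them; so the sum telescopes.\<close>

lemma even_peak_sum_plus_valley_sum_aux:
  assumes "c 0 = 0" "0 < c 1" "\<forall>i<n. c i \<le> c (Suc i)" "0 < n"
  shows "even (peak_sum n c + valley_sum n c - (int (c n) - 1))"
  using assms(4,3)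
proof (induction n rule: nat_induct_non_zero)
  case 1
  \<comment> \<open>The first peak has no valley before it; this is the source of the
    \<open>- 1\<close>.\<close>
  have "peak_pairs 1 c = {(1, c 1)}" "valley_pairs 1 c = {}"
    using assms(1,2) by (auto simp: peak_pairs_def valley_pairs_def)
  then show ?case by (simp add: peak_sum_def valley_sum_def)
next
  case (Suc n)
  show ?case
  proof (cases "c n < c (Suc n)")
    case True
    have "(Suc n, c (Suc n)) \<notin> peak_pairs n c" "(Suc (c n), n) \<notin> valley_pairs n c"
      by (auto simp: peak_pairs_def valley_pairs_def)
    then have "peak_sum (Suc n) c = peak_sum n c + (int (c (Suc n)) - int (Suc n))"
      "valley_sum (Suc n) c = valley_sum n c + (int (Suc (c n)) - int n)"
      using True Suc.hyps
      by (simp_all add: peak_sum_def valley_sum_def peak_pairs_Suc valley_pairs_Suc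
          finite_peak_pairs finite_valley_pairs)
    then show ?thesis using Suc by simp presburger
  next
    case False
    then have "c (Suc n) = c n" using Suc.prems by (simp add: le_antisym)
    with False Suc show ?thesis
      by (simp add: peak_sum_def valley_sum_def peak_pairs_Suc valley_pairs_Suc)
  qed
qed

lemma even_peak_sum_plus_valley_sum:
  assumes "height_fun n c" "1 \<le> n"
  shows "even (peak_sum n c + valley_sum n c - (int n - 1))"
  using even_peak_sum_plus_valley_sum_aux[of c n] assms height_fun_ge[of n c 1]
  by (force simp: height_fun_def)

section \<open>Words of height functions\<close>

primrec height_word :: "(nat \<Rightarrow> nat) \<Rightarrow> nat \<Rightarrow> letter list" where
  "height_word c 0 = []"
| "height_word c (Suc i) = height_word c i @ replicate (c (Suc i) - c i) Up @ [Down]"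

lemma height_word_cong: "(\<And>j. j \<le> i \<Longrightarrow> c j = d j) \<Longrightarrow> height_word c i = height_word d i"
  by (induction i) auto

lemma count_list_replicate: "count_list (replicate k x) y = (if x = y then k else 0)"
  by (induction k) auto

lemma count_height_word:
  assumes "c 0 = 0" "\<forall>i<n. c i \<le> c (Suc i)"
  shows "count_list (height_word c n) Up = c n" "count_list (height_word c n) Down = n"
  using assms by (induction n) (auto simp: count_list_replicate)

section \<open>Peak and valley cells of words\<close>

lemma peak_cells_above_Nil [simp]: "peak_cells_above [] = {}"
  by (simp add: peak_cells_above_def)

lemma valley_cells_below_Nil [simp]: "valley_cells_below [] = {}"
  by (simp add: valley_cells_below_def)

lemma peak_cells_above_singleton [simp]: "peak_cells_above [x] = {}"
  by (simp add: peak_cells_above_def)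

lemma valley_cells_below_singleton [simp]: "valley_cells_below [x] = {}"
  by (simp add: valley_cells_below_def)

text \<open>Earlier prefixes are unchanged, so only the last two letters can contribute a new
  peak.\<close>

lemma peak_cells_above_snoc:
  "peak_cells_above (v @ [y, x]) = peak_cells_above (v @ [y]) \<union>
     (if y = Up \<and> x = Down then {(Suc (count_list v Down), Suc (count_list v Up))} else {})"
proof -
  have *: "(\<exists>t. Suc t < length (v @ [y, x]) \<and> P t) \<longleftrightarrow>
      (\<exists>t. Suc t < length (v @ [y]) \<and> P t) \<or> P (length v)" for P
    by (auto simp: less_Suc_eq)
  show ?thesis
    unfolding peak_cells_above_def *
    by (auto simp: nth_append less_Suc_eq)
qed

lemma valley_cells_below_snoc:
  "valley_cells_below (v @ [y, x]) = valley_cells_below (v @ [y]) \<union>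
     (if y = Down \<and> x = Up then {(Suc (count_list v Up), Suc (count_list v Down))} else {})"
proof -
  have *: "(\<exists>t. Suc t < length (v @ [y, x]) \<and> P t) \<longleftrightarrow>
      (\<exists>t. Suc t < length (v @ [y]) \<and> P t) \<or> P (length v)" for P
    by (auto simp: less_Suc_eq)
  show ?thesis
    unfolding valley_cells_below_def *
    by (auto simp: nth_append less_Suc_eq)
qed

lemma peak_cells_above_snoc_Up: "peak_cells_above (w @ [Up]) = peak_cells_above w"
  by (cases w rule: rev_cases) (auto simp: peak_cells_above_snoc)

lemma peak_cells_above_replicate_Up:
  "peak_cells_above (w @ replicate k Up) = peak_cells_above w"
proof (induction k)
  case (Suc k)
  then show ?case
    using peak_cells_above_snoc_Up[of "w @ replicate k Up"]
    by (simp add: replicate_append_same)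
qed simp

lemma valley_cells_below_snoc_Down: "valley_cells_below (w @ [Down]) = valley_cells_below w"
  by (cases w rule: rev_cases) (auto simp: valley_cells_below_snoc)

text \<open>In a run of \<open>Up\<close> after a \<open>Down\<close>, only the first
  \<open>Up\<close> completes a valley.\<close>

lemma valley_cells_below_replicate_Up:
  "valley_cells_below (v @ Down # replicate k Up) = valley_cells_below (v @ [Down]) \<union>
     (if 0 < k then {(Suc (count_list v Up), Suc (count_list v Down))} else {})"
proof (induction k)
  case (Suc k)
  show ?case
  proof (cases k)
    case 0
    then show ?thesis by (simp add: valley_cells_below_snoc)
  next
    case (Suc m)
    moreover have "replicate m Up @ [Up, Up] = Up # Up # replicate m Up"
      by (induction m) auto
    ultimately have "v @ Down # replicate (Suc k) Up = (v @ Down # replicate m Up) @ [Up, Up]"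
      "v @ Down # replicate k Up = (v @ Down # replicate m Up) @ [Up]"
      by (simp_all add: replicate_append_same)
    then show ?thesis
      using Suc.IH Suc by (simp only: valley_cells_below_snoc) simp
  qed
qed simp

text \<open>Each block is an ascent followed by \<open>Down\<close>. It ends in a peak exactly when
  the ascent is nonempty.\<close>

lemma peak_cells_height_word:
  assumes "c 0 = 0" "\<forall>i<n. c i \<le> c (Suc i)"
  shows "peak_cells_above (height_word c n) = peak_pairs n c"
  using assms(2)
proof (induction n)
  case 0
  then show ?case by (simp add: peak_pairs_def)
next
  case (Suc n)
  show ?case
  proof (cases "c n < c (Suc n)")
    case True
    then obtain k where k: "c (Suc n) - c n = Suc k" by (metis Suc_diff_Suc)
    then have "height_word c (Suc n) = (height_word c n @ replicate k Up) @ [Up, Down]"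
      by (simp add: replicate_append_same)
    moreover have "height_word c n @ replicate k Up @ [Up] =
        height_word c n @ replicate (Suc k) Up"
      by (simp add: replicate_append_same)
    then have "peak_cells_above (height_word c n @ replicate k Up @ [Up]) = peak_pairs n c"
      using Suc peak_cells_above_replicate_Up[of "height_word c n" "Suc k"] by simp
    moreover have "count_list (height_word c n) Up = c n" "count_list (height_word c n) Down = n"
      using Suc.prems by (simp_all add: count_height_word[where c = c, OF assms(1)])
    moreover have "c (Suc n) = Suc (c n + k)" using k by linarith
    ultimately show ?thesis
      by (simp add: peak_cells_above_snoc[of "height_word c n @ replicate k Up", simplified]
          count_list_replicate peak_pairs_Suc del: height_word.simps)
  next
    case False
    then have "height_word c (Suc n) = height_word c n @ [Down]" by simp
    \<comment> \<open>The word ends in \<open>Down, Down\<close>, or is a single \<open>Down\<close>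
      if \<open>n = 0\<close>.\<close>
    moreover have "peak_cells_above (height_word c n @ [Down]) = peak_cells_above (height_word c n)"
    proof (cases n)
      case (Suc m)
      then show ?thesis
        using peak_cells_above_snoc[of "height_word c m @ replicate (c n - c m) Up" Down Down]
        by simp
    qed simp
    ultimately show ?thesis using Suc False by (simp add: peak_pairs_Suc)
  qed
qed

text \<open>A valley arises where the final \<open>Down\<close> of one block meets the ascent of the
  next, so the first block contributes none.\<close>

lemma valley_cells_height_word:
  assumes "c 0 = 0" "\<forall>i<n. c i \<le> c (Suc i)"
  shows "valley_cells_below (height_word c n) = valley_pairs n c"
  using assms(2)
proof (induction n)
  case 0
  then show ?case by (simp add: valley_pairs_def)
next
  case (Suc n)
  have eq: "valley_cells_below (height_word c (Suc n)) =
      valley_cells_below (height_word c n @ replicate (c (Suc n) - c n) Up)"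
    using valley_cells_below_snoc_Down[of "height_word c n @ replicate (c (Suc n) - c n) Up"]
    by simp
  show ?case
  proof (cases n)
    case 0
    have "valley_cells_below (replicate k Up) = {}" for k
      by (auto simp: valley_cells_below_def)
    then show ?thesis using 0 eq by (simp add: valley_pairs_def)
  next
    case (Suc m)
    let ?v = "height_word c m @ replicate (c n - c m) Up"
    have w: "height_word c n = ?v @ [Down]" using Suc by simp
    have "count_list (height_word c n) Up = c n" "count_list (height_word c n) Down = n"
      using Suc.prems by (simp_all add: count_height_word[where c = c, OF assms(1)])
    then have "count_list ?v Up = c n" "Suc (count_list ?v Down) = n"
      unfolding w by simp_all
    then show ?thesis
      using valley_cells_below_replicate_Up[of ?v "c (Suc n) - c n"] eq Suc.IH Suc.prems Suc
      unfolding w by (simp add: valley_pairs_Suc)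
  qed
qed

section \<open>Prefix condition and decomposition of Dyck words\<close>

definition ballot :: "letter list \<Rightarrow> bool" where
  "ballot w \<longleftrightarrow> (\<forall>k\<le>length w. count_list (take k w) Down \<le> count_list (take k w) Up)"

lemma ballot_Nil [simp]: "ballot []"
  by (simp add: ballot_def)

lemma ballot_snoc:
  "ballot (w @ [x]) \<longleftrightarrow> ballot w \<and> count_list (w @ [x]) Down \<le> count_list (w @ [x]) Up"
  unfolding ballot_def by (auto simp: le_Suc_eq)

lemma ballot_replicate_Up: "ballot w \<Longrightarrow> ballot (w @ replicate k Up)"
proof (induction k)
  case (Suc k)
  then have b: "ballot (w @ replicate k Up)" by simp
  then have "count_list (w @ replicate k Up) Down \<le> count_list (w @ replicate k Up) Up"
    unfolding ballot_def by (metis order_refl take_all)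
  then have "ballot ((w @ replicate k Up) @ [Up])"
    using b by (simp add: ballot_snoc del: append_assoc)
  then show ?case by (simp add: replicate_append_same)
qed simp

text \<open>Only a \<open>Down\<close> can violate the prefix condition, and after the
  \<open>i\<close>-th one the counts are \<open>c i\<close> and \<open>i\<close>.\<close>

lemma ballot_height_word:
  assumes "c 0 = 0" "\<forall>i<n. c i \<le> c (Suc i)" "\<forall>i\<le>n. i \<le> c i"
  shows "ballot (height_word c n)"
  using assms(2,3)
proof (induction n)
  case (Suc n)
  then have "ballot (height_word c n)" by simp
  then have "ballot (height_word c n @ replicate (c (Suc n) - c n) Up)"
    by (rule ballot_replicate_Up)
  moreover have "count_list (height_word c (Suc n)) Down \<le> count_list (height_word c (Suc n)) Up"
    using count_height_word[of c "Suc n"] assms(1) Suc.prems by simp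
  ultimately show ?case
    using ballot_snoc[of "height_word c n @ replicate (c (Suc n) - c n) Up" Down] by simp
qed simp

text \<open>Incomplete paths are covered too, so that induction on the last letter works:
  \<open>k\<close> counts the letters \<open>Up\<close> after the last \<open>Down\<close>.\<close>

lemma ballot_decomposition:
  assumes "ballot w"
  shows "\<exists>c k. w = height_word c (count_list w Down) @ replicate k Up \<and> c 0 = 0 \<and>
    (\<forall>i<count_list w Down. c i \<le> c (Suc i)) \<and> (\<forall>i\<le>count_list w Down. i \<le> c i)"
  using assms
proof (induction w rule: rev_induct)
  case Nil
  show ?case by (rule exI[of _ "\<lambda>_. 0"]) simp
next
  case (snoc x w)
  let ?d = "count_list w Down"
  obtain c k where ck: "w = height_word c ?d @ replicate k Up" "c 0 = 0"
    "\<forall>i<?d. c i \<le> c (Suc i)" "\<forall>i\<le>?d. i \<le> c i"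
    using snoc by (auto simp: ballot_snoc)
  show ?case
  proof (cases x)
    case Up
    then have "w @ [x] = height_word c ?d @ replicate (Suc k) Up"
      using ck(1) by (metis append_assoc replicate_append_same replicate_Suc)
    moreover have "count_list (w @ [x]) Down = ?d"
      using Up by simp
    ultimately show ?thesis
      using ck(2-4) by metis
  next
    case Down
    \<comment> \<open>A \<open>Down\<close> closes the pending ascent: its \<open>k\<close> letters
      enter the next height, and nothing is pending afterwards.\<close>
    define c' where "c' = (\<lambda>i. if i = Suc ?d then c ?d + k else c i)"
    have c': "c' (Suc ?d) = c ?d + k" "\<And>i. i \<le> ?d \<Longrightarrow> c' i = c i"
      by (simp_all add: c'_def)
    have "height_word c' ?d = height_word c ?d"
      by (rule height_word_cong) (simp add: c')
    then have "w @ [x] = height_word c' (Suc ?d)"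
      using ck(1) Down c' by simp
    moreover have "count_list w Up = c ?d + k"
      using arg_cong[OF ck(1), of "\<lambda>w. count_list w Up"] count_height_word(1)[OF ck(2,3)]
      by (simp add: count_list_replicate)
    then have "Suc ?d \<le> c ?d + k"
      using snoc.prems Down by (simp add: ballot_snoc)
    ultimately show ?thesis
      using ck(2-4) Down c'
      by (intro exI[of _ c'] exI[of _ 0]) (auto simp: less_Suc_eq le_Suc_eq)
  qed
qed

lemma height_word_in_dyck: "height_fun n c \<Longrightarrow> height_word c n \<in> dyck n"
  using count_height_word[of c n] ballot_height_word[of c n]
  unfolding dyck_def height_fun_def ballot_def by auto

text \<open>No ascent is pending at the end, since \<open>n \<le> c n\<close> already accounts for
  all letters \<open>Up\<close>.\<close>

lemma dyck_height_word:
  assumes "w \<in> dyck n"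
  obtains c where "height_fun n c" "w = height_word c n"
proof -
  have w: "ballot w" "count_list w Up = n" "count_list w Down = n"
    using assms by (auto simp: dyck_def ballot_def)
  obtain c k where ck: "w = height_word c n @ replicate k Up" "c 0 = 0"
    "\<forall>i<n. c i \<le> c (Suc i)" "\<forall>i\<le>n. i \<le> c i"
    using ballot_decomposition[OF w(1)] w(3) by auto
  have "c n + k = n"
    using arg_cong[OF ck(1), of "\<lambda>w. count_list w Up"] count_height_word(1)[OF ck(2,3)] w(2)
    by (simp add: count_list_replicate)
  moreover have "n \<le> c n" using ck(4) by simp
  ultimately have "k = 0" "c n = n" by linarith+
  then show thesis
    using that[of c] ck by (simp add: height_fun_def)
qed

section \<open>Evaluation of \<open>E_p\<close> and \<open>D_v\<close>\<close>

lemma height_word_peak_cells: "height_fun n c \<Longrightarrow> peak_cells_above (height_word c n) = peak_pairs n c"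
  by (simp add: height_fun_def peak_cells_height_word)

lemma height_word_valley_cells:
  "height_fun n c \<Longrightarrow> valley_cells_below (height_word c n) = valley_pairs n c"
  by (simp add: height_fun_def valley_cells_height_word)

text \<open>Any competing Dyck word comes from a height function, so uniqueness reduces to
  \<open>peak_pairs_inj\<close>.\<close>

lemma E_p_eqI:
  assumes "height_fun n c" "peak_pairs n c = {(i, p i) | i. i \<in> {1..n} \<and> p i \<ge> i}"
  shows "E_p n p = height_word c n"
  unfolding E_p_def
proof (rule the_equality)
  show "height_word c n \<in> dyck n \<and>
      peak_cells_above (height_word c n) = {(i, p i) | i. i \<in> {1..n} \<and> p i \<ge> i}"
    using assms by (simp add: height_word_in_dyck height_word_peak_cells)
next
  fix w assume w: "w \<in> dyck n \<and> peak_cells_above w = {(i, p i) | i. i \<in> {1..n} \<and> p i \<ge> i}"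
  then obtain d where d: "height_fun n d" "w = height_word d n"
    by (auto elim: dyck_height_word)
  then have "peak_pairs n c = peak_pairs n d"
    using w assms(2) height_word_peak_cells[OF d(1)] by simp
  then show "w = height_word c n"
    unfolding d(2) using peak_pairs_inj[OF assms(1) d(1)] by (intro height_word_cong) simp
qed

lemma D_v_eqI:
  assumes "height_fun n c" "valley_pairs n c = {(i, p i) | i. i \<in> {1..n} \<and> p i < i}"
  shows "D_v n p = height_word c n"
  unfolding D_v_def
proof (rule the_equality)
  show "height_word c n \<in> dyck n \<and>
      valley_cells_below (height_word c n) = {(i, p i) | i. i \<in> {1..n} \<and> p i < i}"
    using assms by (simp add: height_word_in_dyck height_word_valley_cells)
next
  fix w assume w: "w \<in> dyck n \<and> valley_cells_below w = {(i, p i) | i. i \<in> {1..n} \<and> p i < i}"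
  then obtain d where d: "height_fun n d" "w = height_word d n"
    by (auto elim: dyck_height_word)
  then have "valley_pairs n c = valley_pairs n d"
    using w assms(2) height_word_valley_cells[OF d(1)] by simp
  then show "w = height_word c n"
    unfolding d(2) using valley_pairs_inj[OF assms(1) d(1)] by (intro height_word_cong) simp
qed

section \<open>321-avoiding permutations\<close>

lemma S321_permutes: "p \<in> S321 n \<Longrightarrow> p permutes {1..n}"
  by (simp add: S321_def)

lemma permutes_atLeastAtMost_in:
  "p permutes {1..n::nat} \<Longrightarrow> i \<in> {1..n} \<Longrightarrow> p i \<in> {1..n}"
  by (simp only: permutes_in_image)

lemma S321_no_321:
  assumes "p \<in> S321 n" "1 \<le> i" "i < j" "j < k" "k \<le> n" "p j < p i" "p k < p j"
  shows False
proof -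
  have "i \<in> {1..n}" "j \<in> {1..n}" "k \<in> {1..n}" using assms(2-5) by simp_all
  then have "\<not> avoids_321 n p" using assms(3,4,6,7) unfolding avoids_321_def by blast
  then show False using assms(1) by (simp add: S321_def)
qed

text \<open>If \<open>p k < p i\<close>, some \<open>h < i\<close> has \<open>p h > p i\<close>:
  otherwise the \<open>i\<close> positions \<open>1, ..., i - 1, k\<close> would share the fewer
  than \<open>i\<close> values below \<open>p i\<close>. Then \<open>h, i, k\<close> is a 321
  pattern.\<close>

lemma S321_less_of_not_excedance:
  assumes p: "p \<in> S321 n" and i: "i \<in> {1..n}" "p i \<le> i" and k: "k \<in> {1..n}" "i < k"
  shows "p i < p k"
proof (rule ccontr)
  assume "\<not> p i < p k"
  have perm: "p permutes {1..n}" using p by (rule S321_permutes)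
  have "p i \<noteq> p k" using permutes_inj[OF perm] k(2) by (auto dest: injD)
  with \<open>\<not> p i < p k\<close> have ki: "p k < p i" by simp
  have "\<exists>h\<in>{1..<i}. p i < p h"
  proof (rule ccontr)
    assume none: "\<not> (\<exists>h\<in>{1..<i}. p i < p h)"
    have "p h < p i" if "h \<in> {1..<i}" for h
    proof -
      have "p h \<noteq> p i" using permutes_inj[OF perm] that by (auto dest: injD)
      then show ?thesis using none that by force
    qed
    then have "p ` insert k {1..<i} \<subseteq> {1..<p i}"
      using ki permutes_atLeastAtMost_in[OF perm] i(1) k by fastforce
    then have "card (p ` insert k {1..<i}) \<le> card {1..<p i}"
      by (intro card_mono) simp_all
    moreover have "card (p ` insert k {1..<i}) = card (insert k {1..<i})"
      by (intro card_image inj_on_subset[OF permutes_inj[OF perm]]) simp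
    ultimately show False using i k(2) by simp
  qed
  then obtain h where h: "h \<in> {1..<i}" "p i < p h" by blast
  then show False using S321_no_321[OF p, of h i k] ki k by simp
qed

text \<open>If \<open>p h > p i\<close>, the \<open>p i - 1\<close> values below \<open>p i\<close>
  cannot all be taken at the \<open>i - 2\<close> earlier positions other than \<open>h\<close>. So
  one is taken at some \<open>k > i\<close>, and \<open>h, i, k\<close> is a 321 pattern.\<close>

lemma S321_less_of_weak_excedance:
  assumes p: "p \<in> S321 n" and i: "i \<in> {1..n}" "i \<le> p i" and h: "h \<in> {1..n}" "h < i"
  shows "p h < p i"
proof (rule ccontr)
  assume "\<not> p h < p i"
  have perm: "p permutes {1..n}" using p by (rule S321_permutes)
  have "p h \<noteq> p i" using permutes_inj[OF perm] h(2) by (auto dest: injD)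
  with \<open>\<not> p h < p i\<close> have hi: "p i < p h" by simp
  have "\<not> {1..<p i} \<subseteq> p ` ({1..<i} - {h})"
  proof
    assume "{1..<p i} \<subseteq> p ` ({1..<i} - {h})"
    then have "card {1..<p i} \<le> card (p ` ({1..<i} - {h}))"
      by (intro card_mono) simp_all
    also have "\<dots> \<le> card ({1..<i} - {h})"
      by (rule card_image_le) simp
    finally show False using i h by simp
  qed
  then obtain v where v: "v \<in> {1..<p i}" "v \<notin> p ` ({1..<i} - {h})" by blast
  moreover have "v \<in> {1..n}"
    using v(1) permutes_atLeastAtMost_in[OF perm i(1)] by auto
  ultimately obtain k where k: "k \<in> {1..n}" "p k = v"
    using permutes_image[OF perm] by (metis imageE)
  have "k \<noteq> h" "k \<noteq> i" using k v(1) hi by auto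
  then have "i < k" using k v(2) by (metis DiffI atLeastAtMost_iff atLeastLessThan_iff
        imageI nat_neq_iff singletonD)
  then show False using S321_no_321[OF p, of h i k] hi k v(1) h by simp
qed

text \<open>At a first disagreement \<open>q\<close> must take the value \<open>p i\<close> after
  position \<open>i\<close>, but there it has only values above \<open>q i\<close>, since
  \<open>i\<close> is not an excedance of \<open>q\<close>.\<close>

lemma S321_eqI_aux:
  assumes p: "p \<in> S321 n" and q: "q \<in> S321 n"
    and i: "i \<in> {1..n}" "q i \<le> i" and less: "p i < q i" and IH: "\<forall>j<i. p j = q j"
  shows False
proof -
  have pp: "p permutes {1..n}" and qp: "q permutes {1..n}"
    by (rule S321_permutes[OF p], rule S321_permutes[OF q])
  have "p i \<in> q ` {1..n}"
    using permutes_atLeastAtMost_in[OF pp i(1)] permutes_image[OF qp] by simp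
  then obtain j where j: "j \<in> {1..n}" "q j = p i" by auto
  have "\<not> j < i" using IH j injD[OF permutes_inj[OF pp], of j i] by auto
  moreover have "j \<noteq> i" using j less by auto
  ultimately have "q i < q j" using S321_less_of_not_excedance[OF q i j(1)] by simp
  then show False using j less by simp
qed

text \<open>An excedance of either permutation is read off from the set; at a common non-excedance
  \<open>S321_eqI_aux\<close> applies in both orders. Injectivity of \<open>Exc\<close> and of
  \<open>E_p\<close> rests on this.\<close>

lemma S321_eqI:
  assumes p: "p \<in> S321 n" and q: "q \<in> S321 n"
    and eq: "{(i, p i) | i. i \<in> {1..n} \<and> p i > i} = {(i, q i) | i. i \<in> {1..n} \<and> q i > i}"
  shows "p = q"
proof
  fix i
  show "p i = q i"
  proof (induction i rule: less_induct)
    case (less i)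
    show ?case
    proof (cases "i \<in> {1..n}")
      case False
      then show ?thesis
        using p q S321_permutes permutes_not_in by metis
    next
      case i: True
      have mem: "(i, m) \<in> {(i, p i) | i. i \<in> {1..n} \<and> p i > i} \<longleftrightarrow>
          (i, m) \<in> {(i, q i) | i. i \<in> {1..n} \<and> q i > i}" for m
        using eq by simp
      show ?thesis
      proof (cases "p i > i \<or> q i > i")
        case True
        then show ?thesis using mem[of "p i"] mem[of "q i"] i by auto
      next
        case False
        then show ?thesis
          using S321_eqI_aux[OF p q i] S321_eqI_aux[OF q p i] less.IH
          by (metis linorder_neqE_nat not_less)
      qed
    qed
  qed
qed

lemma weak_excedances_eq_imp_excedances_eq:
  assumes "{(i, p i) | i. i \<in> {1..n} \<and> p i \<ge> i} = {(i, q i) | i. i \<in> {1..n} \<and> q i \<ge> i}"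
  shows "{(i, p i) | i. i \<in> {1..n} \<and> p i > i} = {(i, q i) | i. i \<in> {1..n} \<and> q i > (i::nat)}"
proof -
  have *: "{(i, r i) | i. i \<in> {1..n} \<and> r i > i} =
      {(i, j) \<in> {(i, r i) | i. i \<in> {1..n} \<and> r i \<ge> i}. i < j}" for r :: "nat \<Rightarrow> nat"
    by auto
  show ?thesis unfolding *[of p] *[of q] assms ..
qed

lemma inj_on_Exc: "inj_on (Exc n) (S321 n)"
proof (rule inj_onI)
  fix p q assume p: "p \<in> S321 n" and q: "q \<in> S321 n" and eq: "Exc n p = Exc n q"
  \<comment> \<open>With \<open>i < m\<close> the interval is nonempty, so it determines its
    endpoints, and \<open>m - 1\<close> is not truncated.\<close>
  have *: "(i, m) \<in> {(i, r i) | i. i \<in> {1..n} \<and> r i > i} \<longleftrightarrow> i < m \<and> {i..m - 1} \<in> Exc n r"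
    for r i m
  proof
    assume "i < m \<and> {i..m - 1} \<in> Exc n r"
    then obtain j where "i < m" "j \<in> {1..n}" "r j > j" "{i..m - 1} = {j..r j - 1}"
      unfolding Exc_def by auto
    moreover from this have "i = j \<and> m - 1 = r j - 1"
      by (subst (asm) Icc_eq_Icc) auto
    ultimately show "(i, m) \<in> {(i, r i) | i. i \<in> {1..n} \<and> r i > i}"
      by auto
  qed (auto simp: Exc_def)
  have "{(i, p i) | i. i \<in> {1..n} \<and> p i > i} = {(i, q i) | i. i \<in> {1..n} \<and> q i > i}"
    by (intro set_eqI) (auto simp only: split_paired_all * eq)
  then show "p = q" by (rule S321_eqI[OF p q])
qed

text \<open>By \<open>S321_less_of_not_excedance\<close> every inversion starts at a weak excedance
  \<open>i\<close>. Of the \<open>p i - 1\<close> smaller values, \<open>i - 1\<close> come earlier,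
  and each of the other \<open>p i - i\<close> gives an inversion.\<close>

lemma card_inversions_S321:
  assumes p: "p \<in> S321 n"
  shows "card (inversions n p) = (\<Sum>i\<in>{i \<in> {1..n}. i \<le> p i}. p i - i)"
proof -
  have perm: "p permutes {1..n}" using p by (rule S321_permutes)
  let ?E = "{i \<in> {1..n}. i \<le> p i}"
  have "inversions n p = (SIGMA i:?E. {k \<in> {1..n}. i < k \<and> p k < p i})"
  proof -
    have "i \<le> p i" if "i \<in> {1..n}" "k \<in> {1..n}" "i < k" "p k < p i" for i k
      using S321_less_of_not_excedance[OF p that(1) _ that(2,3)] that(4) by force
    then show ?thesis unfolding inversions_def by auto
  qed
  then have "card (inversions n p) = (\<Sum>i\<in>?E. card {k \<in> {1..n}. i < k \<and> p k < p i})"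
    by (simp add: card_SigmaI)
  also have "\<dots> = (\<Sum>i\<in>?E. p i - i)"
  proof (rule sum.cong[OF refl])
    fix i assume i: "i \<in> ?E"
    let ?K = "{k \<in> {1..n}. i < k \<and> p k < p i}"
    have "p ` ({1..<i} \<union> ?K) = {1..<p i}"
    proof (intro equalityI subsetI)
      fix v assume "v \<in> p ` ({1..<i} \<union> ?K)"
      then show "v \<in> {1..<p i}"
        using S321_less_of_weak_excedance[OF p] permutes_atLeastAtMost_in[OF perm] i by fastforce
    next
      fix v assume v: "v \<in> {1..<p i}"
      then have "v \<in> p ` {1..n}"
        using permutes_image[OF perm] permutes_atLeastAtMost_in[OF perm, of i] i by auto
      then show "v \<in> p ` ({1..<i} \<union> ?K)"
      proof
        fix k assume k: "v = p k" "k \<in> {1..n}"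
        then have "k < i \<or> k = i \<or> i < k" "p k < p i" using v by auto
        with k show ?thesis by auto
      qed
    qed
    moreover have "card (p ` ({1..<i} \<union> ?K)) = card ({1..<i} \<union> ?K)"
      by (intro card_image inj_on_subset[OF permutes_inj[OF perm]]) simp
    moreover have "card ({1..<i} \<union> ?K) = card {1..<i} + card ?K"
      by (intro card_Un_disjoint) auto
    ultimately have "card {1..<p i} = card {1..<i} + card ?K" by metis
    then have "p i - 1 = (i - 1) + card ?K" by (simp only: card_atLeastLessThan)
    moreover have "1 \<le> i" "i \<le> p i" using i by simp_all
    ultimately show "card ?K = p i - i" by linarith
  qed
  finally show ?thesis .
qed

section \<open>Permutations and height functions\<close>

text \<open>\<open>Max\<close> of the empty set is unspecified, hence the separate value at
  0.\<close>

definition height_of :: "(nat \<Rightarrow> nat) \<Rightarrow> nat \<Rightarrow> nat" where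
  "height_of p i = (if i = 0 then 0 else Max (p ` {1..i}))"

lemma height_of_less_iff: "height_of p i < m \<longleftrightarrow> 0 < m \<and> (\<forall>j\<in>{1..i}. p j < m)"
proof (cases "i = 0")
  case False
  then have "1 \<in> {1..i}" by simp
  then have "(\<forall>j\<in>{1..i}. p j < m) \<Longrightarrow> 0 < m" by fastforce
  with False show ?thesis by (auto simp: height_of_def)
qed (simp add: height_of_def)

lemma height_of_Suc: "height_of p (Suc i) = max (height_of p i) (p (Suc i))"
proof (cases "i = 0")
  case False
  have "{1..Suc i} = insert (Suc i) {1..i}" by auto
  with False show ?thesis by (simp add: height_of_def max.commute)
qed (simp add: height_of_def)

lemma height_of_attained: "1 \<le> i \<Longrightarrow> \<exists>j\<in>{1..i}. height_of p i = p j"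
  using Max_in[of "p ` {1..i}"] by (simp add: height_of_def image_iff)

lemma le_height_of: "j \<in> {1..i} \<Longrightarrow> p j \<le> height_of p i"
  by (auto simp: height_of_def)

text \<open>The Dyck condition holds since the first \<open>i\<close> values are distinct and lie in
  \<open>{1..height_of p i}\<close>.\<close>

lemma height_fun_height_of:
  assumes perm: "p permutes {1..n}"
  shows "height_fun n (height_of p)"
proof -
  have ge: "i \<le> height_of p i" if "i \<le> n" for i
  proof -
    have "p ` {1..i} \<subseteq> {1..height_of p i}"
      using le_height_of permutes_atLeastAtMost_in[OF perm] that by fastforce
    then have "card (p ` {1..i}) \<le> card {1..height_of p i}"
      by (intro card_mono) simp_all
    moreover have "card (p ` {1..i}) = card {1..i}"
      by (intro card_image inj_on_subset[OF permutes_inj[OF perm]]) simp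
    ultimately show ?thesis by simp
  qed
  have "height_of p n < Suc n"
    unfolding height_of_less_iff using permutes_atLeastAtMost_in[OF perm]
    by (auto simp: less_Suc_eq_le)
  then have "height_of p n = n" using ge[of n] by simp
  then show ?thesis
    using ge by (auto simp: height_fun_def height_of_Suc) (simp add: height_of_def)
qed

text \<open>Weak excedances are the strict prefix maxima: they exceed all earlier values, and
  conversely a new maximum exceeds \<open>height_of p (i - 1) \<ge> i - 1\<close>.\<close>

lemma peak_pairs_height_of:
  assumes p: "p \<in> S321 n"
  shows "peak_pairs n (height_of p) = {(i, p i) | i. i \<in> {1..n} \<and> p i \<ge> i}"
proof -
  have perm: "p permutes {1..n}" using p by (rule S321_permutes)
  have *: "height_of p (i - 1) < height_of p i \<longleftrightarrow> i \<le> p i"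
    "i \<le> p i \<longrightarrow> height_of p i = p i" if i: "i \<in> {1..n}" for i
  proof -
    have eq: "height_of p i = max (height_of p (i - 1)) (p i)"
      using height_of_Suc[of p "i - 1"] i by simp
    have "i \<le> p i \<longleftrightarrow> height_of p (i - 1) < p i"
    proof
      assume "i \<le> p i"
      then show "height_of p (i - 1) < p i"
        unfolding height_of_less_iff using S321_less_of_weak_excedance[OF p i] i by auto
    next
      assume "height_of p (i - 1) < p i"
      moreover have "i - 1 \<le> height_of p (i - 1)"
        using height_fun_ge[OF height_fun_height_of[OF perm], of "i - 1"] i by auto
      ultimately show "i \<le> p i" by simp
    qed
    then show "height_of p (i - 1) < height_of p i \<longleftrightarrow> i \<le> p i"
      "i \<le> p i \<longrightarrow> height_of p i = p i"
      using eq by auto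
  qed
  show ?thesis
    unfolding peak_pairs_def
  proof (intro Collect_cong ex_cong1)
    fix u i
    show "u = (i, height_of p i) \<and> i \<in> {1..n} \<and> height_of p (i - 1) < height_of p i \<longleftrightarrow>
        u = (i, p i) \<and> i \<in> {1..n} \<and> i \<le> p i"
      using *[of i] by auto
  qed
qed

text \<open>Non-records take the least unused value.\<close>

lemma ex_partial_injection_of_heights:
  assumes c: "height_fun n c" and "m \<le> n"
  shows "\<exists>p. inj_on p {1..m} \<and> (\<forall>i\<in>{1..m}. 1 \<le> p i \<and> p i \<le> c i) \<and>
    (\<forall>i\<in>{1..m}. if c (i - 1) < c i then p i = c i else p i < i \<and> {1..p i} \<subseteq> p ` {1..i})"
  using assms(2)
proof (induction m)
  case (Suc m)
  then obtain p where p: "inj_on p {1..m}" "\<forall>i\<in>{1..m}. 1 \<le> p i \<and> p i \<le> c i"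
    "\<forall>i\<in>{1..m}. if c (i - 1) < c i then p i = c i else p i < i \<and> {1..p i} \<subseteq> p ` {1..i}"
    by auto
  have *: "\<exists>v. 1 \<le> v \<and> v \<le> c (Suc m) \<and> v \<notin> p ` {1..m} \<and>
      (if c m < c (Suc m) then v = c (Suc m) else v \<le> m \<and> {1..<v} \<subseteq> p ` {1..m})"
  proof (cases "c m < c (Suc m)")
    case True
    have "p i < c (Suc m)" if "i \<in> {1..m}" for i
      using p(2) that height_fun_mono[OF c, of i m] Suc.prems True by fastforce
    then have "c (Suc m) \<notin> p ` {1..m}" by force
    then show ?thesis using True by (intro exI[of _ "c (Suc m)"]) simp
  next
    case False
    then have cm: "c m = c (Suc m)"
      using c Suc.prems by (simp add: height_fun_def le_antisym)
    then have "Suc m \<le> c m" using height_fun_ge[OF c Suc.prems] by simp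
    \<comment> \<open>\<open>j\<close> starts the current plateau, and \<open>p j = c m\<close>
      exceeds \<open>m\<close>. So at most \<open>m - 1\<close> of the values
      \<open>1, ..., m\<close> are used, and one is free.\<close>
    define j where "j = (LEAST j. c j = c m)"
    have cj: "c j = c m" "j \<le> m"
      unfolding j_def by (rule LeastI[of _ m], simp) (rule Least_le, simp)
    have "j \<noteq> 0"
    proof
      assume "j = 0"
      then have "c m = 0" using cj(1) c by (simp add: height_fun_def)
      then show False using \<open>Suc m \<le> c m\<close> by simp
    qed
    then have "c (j - 1) \<noteq> c m"
      unfolding j_def using not_less_Least[of "j - 1" "\<lambda>j. c j = c m"] by (simp add: j_def)
    then have "c (j - 1) < c j"
      using height_fun_mono[OF c, of "j - 1" j] cj Suc.prems by simp
    then have "p j = c m" using p(3) cj \<open>j \<noteq> 0\<close> by auto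
    have "\<not> {1..m} \<subseteq> p ` ({1..m} - {j})"
    proof
      assume "{1..m} \<subseteq> p ` ({1..m} - {j})"
      then have "card {1..m} \<le> card (p ` ({1..m} - {j}))" by (intro card_mono) simp_all
      also have "\<dots> \<le> card ({1..m} - {j})" by (rule card_image_le) simp
      finally show False using cj(2) \<open>j \<noteq> 0\<close> by simp
    qed
    then have ex: "\<exists>v. v \<in> {1..m} \<and> v \<notin> p ` {1..m}"
      using \<open>p j = c m\<close> \<open>Suc m \<le> c m\<close> by fastforce
    define v where "v = (LEAST v. v \<in> {1..m} \<and> v \<notin> p ` {1..m})"
    have v: "v \<in> {1..m}" "v \<notin> p ` {1..m}"
      using LeastI_ex[OF ex] by (simp_all add: v_def)
    moreover have "{1..<v} \<subseteq> p ` {1..m}"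
    proof
      fix u assume "u \<in> {1..<v}"
      then show "u \<in> p ` {1..m}"
        using not_less_Least[of u "\<lambda>v. v \<in> {1..m} \<and> v \<notin> p ` {1..m}", folded v_def] v(1)
        by simp
    qed
    ultimately show ?thesis
      using False cm \<open>Suc m \<le> c m\<close> by (intro exI[of _ v]) auto
  qed
  then obtain v where v: "1 \<le> v" "v \<le> c (Suc m)" "v \<notin> p ` {1..m}"
    "if c m < c (Suc m) then v = c (Suc m) else v \<le> m \<and> {1..<v} \<subseteq> p ` {1..m}"
    by blast
  define q where "q = p(Suc m := v)"
  have q: "q (Suc m) = v" "\<And>i. i \<le> m \<Longrightarrow> q i = p i" by (simp_all add: q_def)
  have img: "q ` {1..i} = p ` {1..i}" if "i \<le> m" for i
    using that q(2) by (intro image_cong) auto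
  have Suc_eq: "{1..Suc m} = insert (Suc m) {1..m}" by auto
  have "inj_on q {1..m}" using p(1) inj_on_cong[of "{1..m}" q p] q(2) by simp
  moreover have "q (Suc m) \<notin> q ` {1..m}" using v(3) q(1) img[of m] by simp
  ultimately have inj: "inj_on q {1..Suc m}"
    unfolding Suc_eq inj_on_insert by blast
  have bounds: "\<forall>i\<in>{1..Suc m}. 1 \<le> q i \<and> q i \<le> c i"
    using p(2) v(1,2) q by (auto simp: le_Suc_eq)
  have "\<forall>i\<in>{1..m}. if c (i - 1) < c i then q i = c i else q i < i \<and> {1..q i} \<subseteq> q ` {1..i}"
  proof
    fix i assume i: "i \<in> {1..m}"
    then have "q i = p i" "q ` {1..i} = p ` {1..i}" using q(2) img by simp_all
    with bspec[OF p(3) i] show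
      "if c (i - 1) < c i then q i = c i else q i < i \<and> {1..q i} \<subseteq> q ` {1..i}"
      by (simp split: if_splits)
  qed
  moreover have "if c (Suc m - 1) < c (Suc m) then q (Suc m) = c (Suc m)
      else q (Suc m) < Suc m \<and> {1..q (Suc m)} \<subseteq> q ` {1..Suc m}"
  proof (cases "c m < c (Suc m)")
    case False
    then have "{1..<v} \<subseteq> p ` {1..m}" "v \<le> m" using v(4) by simp_all
    moreover have "{1..v} = insert v {1..<v}" using v(1) by auto
    ultimately show ?thesis
      using False q(1) img[of m] unfolding Suc_eq by auto
  qed (use v(4) q in simp)
  ultimately have "\<forall>i\<in>insert (Suc m) {1..m}.
      if c (i - 1) < c i then q i = c i else q i < i \<and> {1..q i} \<subseteq> q ` {1..i}"
    unfolding ball_simps by (intro conjI)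
  then have "\<forall>i\<in>{1..Suc m}.
      if c (i - 1) < c i then q i = c i else q i < i \<and> {1..q i} \<subseteq> q ` {1..i}"
    by (simp only: Suc_eq[symmetric])
  with inj bounds show ?case by (intro exI[of _ q] conjI)
qed auto

text \<open>In a 321 pattern \<open>i < j < k\<close> the middle position is no record, as
  \<open>p j < p i \<le> c i \<le> c j\<close>. Then the values up to \<open>p j\<close> are all
  used by position \<open>j\<close>, and \<open>p k\<close> would be taken twice.\<close>

lemma ex_S321_of_heights:
  assumes c: "height_fun n c"
  obtains p where "p \<in> S321 n" "{(i, p i) | i. i \<in> {1..n} \<and> p i \<ge> i} = peak_pairs n c"
proof -
  obtain p where p: "inj_on p {1..n}" "\<forall>i\<in>{1..n}. 1 \<le> p i \<and> p i \<le> c i"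
    "\<forall>i\<in>{1..n}. if c (i - 1) < c i then p i = c i else p i < i \<and> {1..p i} \<subseteq> p ` {1..i}"
    using ex_partial_injection_of_heights[OF c order_refl] by blast
  define q where "q i = (if i \<in> {1..n} then p i else i)" for i
  have q: "q i = p i" if "i \<in> {1..n}" for i using that by (simp add: q_def)
  have "p ` {1..n} \<subseteq> {1..n}"
    using p(2) height_fun_le[OF c] by fastforce
  then have "p ` {1..n} = {1..n}"
    by (rule card_subset_eq[OF finite_atLeastAtMost _ card_image[OF p(1)]])
  then have "bij_betw p {1..n} {1..n}" using p(1) by (simp add: bij_betw_def)
  then have "bij_betw q {1..n} {1..n}" using bij_betw_cong[of "{1..n}" q p] q by blast
  then have "q permutes {1..n}"
    by (rule bij_imp_permutes) (auto simp: q_def)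
  moreover have "avoids_321 n q"
    unfolding avoids_321_def
  proof safe
    fix i j k assume ijk: "i \<in> {1..n}" "j \<in> {1..n}" "k \<in> {1..n}" "i < j" "j < k"
      and gt: "q j < q i" "q k < q j"
    have "p i \<le> c i" using p(2) ijk by simp
    also have "c i \<le> c j" using height_fun_mono[OF c, of i j] ijk by simp
    finally have "p j \<noteq> c j" using gt ijk q by simp
    then have "{1..p j} \<subseteq> p ` {1..j}" using p(3) ijk(2) by (auto split: if_splits)
    moreover have "p k \<in> {1..p j}" using p(2) gt ijk q by simp
    ultimately obtain l where "l \<in> {1..j}" "p k = p l" by auto
    then show False using inj_onD[OF p(1), of k l] ijk by auto
  qed
  moreover have "{(i, q i) | i. i \<in> {1..n} \<and> q i \<ge> i} = peak_pairs n c"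
  proof -
    have "i \<le> p i \<longleftrightarrow> c (i - 1) < c i" "c (i - 1) < c i \<longrightarrow> p i = c i" if "i \<in> {1..n}" for i
      using bspec[OF p(3) that] that height_fun_ge[OF c, of i] by (simp_all split: if_splits)
    then show ?thesis unfolding peak_pairs_def using q height_fun_ge[OF c] by auto
  qed
  ultimately show thesis using that[of q] by (simp add: S321_def)
qed

section \<open>Inversion numbers as sums over peaks and valleys\<close>

lemma card_inversions_eq_peak_sum:
  assumes p: "p \<in> S321 n"
    and eq: "{(i, p i) | i. i \<in> {1..n} \<and> p i \<ge> i} = peak_pairs n c"
  shows "int (card (inversions n p)) = peak_sum n c"
proof -
  let ?E = "{i \<in> {1..n}. i \<le> p i}"
  have "peak_pairs n c = (\<lambda>i. (i, p i)) ` ?E" using eq by auto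
  then have "peak_sum n c = (\<Sum>i\<in>?E. int (p i) - int i)"
    unfolding peak_sum_def by (simp add: sum.reindex inj_on_def)
  also have "\<dots> = int (\<Sum>i\<in>?E. p i - i)"
    unfolding of_nat_sum by (intro sum.cong) (auto simp: of_nat_diff)
  finally show ?thesis using card_inversions_S321[OF p] by simp
qed

text \<open>Fixed points contribute 0, so strict and weak excedances give the same sum.\<close>

lemma card_inversions_eq_valley_sum_excedances:
  assumes p: "p \<in> S321 n"
    and eq: "{(p i, i) | i. i \<in> {1..n} \<and> p i > i} = valley_pairs n c"
  shows "int (card (inversions n p)) = valley_sum n c"
proof -
  let ?E = "{i \<in> {1..n}. i < p i}"
  have "valley_pairs n c = (\<lambda>i. (p i, i)) ` ?E" using eq by auto
  then have "valley_sum n c = (\<Sum>i\<in>?E. int (p i) - int i)"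
    unfolding valley_sum_def by (simp add: sum.reindex inj_on_def)
  also have "\<dots> = (\<Sum>i\<in>{i \<in> {1..n}. i \<le> p i}. int (p i) - int i)"
    by (intro sum.mono_neutral_left) auto
  also have "\<dots> = int (\<Sum>i\<in>{i \<in> {1..n}. i \<le> p i}. p i - i)"
    unfolding of_nat_sum by (intro sum.cong) (auto simp: of_nat_diff)
  finally show ?thesis using card_inversions_S321[OF p] by simp
qed

text \<open>\<open>p i - i\<close> sums to 0 over \<open>{1..n}\<close>, so excedances and
  antiexcedances have the same total distance from the diagonal.\<close>

lemma card_inversions_eq_valley_sum_antiexcedances:
  assumes p: "p \<in> S321 n"
    and eq: "{(i, p i) | i. i \<in> {1..n} \<and> p i < i} = valley_pairs n c"
  shows "int (card (inversions n p)) = valley_sum n c"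
proof -
  let ?E = "{i \<in> {1..n}. i \<le> p i}" and ?A = "{i \<in> {1..n}. p i < i}"
  have "valley_pairs n c = (\<lambda>i. (i, p i)) ` ?A" using eq by auto
  then have "valley_sum n c = (\<Sum>i\<in>?A. int i - int (p i))"
    unfolding valley_sum_def by (simp add: sum.reindex inj_on_def)
  also have "\<dots> = (\<Sum>i\<in>?E. int (p i) - int i)"
  proof -
    have "(\<Sum>i\<in>{1..n}. int (p i)) = (\<Sum>i\<in>{1..n}. int i)"
      using sum.permute[OF S321_permutes[OF p], of int] by (simp add: comp_def)
    then have "(\<Sum>i\<in>{1..n}. int (p i) - int i) = 0"
      by (simp add: sum_subtractf)
    moreover have "(\<Sum>i\<in>{1..n}. int (p i) - int i) =
        (\<Sum>i\<in>?E. int (p i) - int i) + (\<Sum>i\<in>?A. int (p i) - int i)"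
    proof -
      have "(\<Sum>i\<in>?E \<union> ?A. int (p i) - int i) =
          (\<Sum>i\<in>?E. int (p i) - int i) + (\<Sum>i\<in>?A. int (p i) - int i)"
        by (intro sum.union_disjoint) auto
      moreover have "?E \<union> ?A = {1..n}" by auto
      ultimately show ?thesis by (simp only:)
    qed
    moreover have "(\<Sum>i\<in>?A. int i - int (p i)) = - (\<Sum>i\<in>?A. int (p i) - int i)"
      by (simp add: sum_negf[symmetric])
    ultimately show ?thesis by simp
  qed
  also have "\<dots> = int (\<Sum>i\<in>?E. p i - i)"
    unfolding of_nat_sum by (intro sum.cong) (auto simp: of_nat_diff)
  finally show ?thesis using card_inversions_S321[OF p] by simp
qed

text \<open>Used for both maps: when one path accounts for \<open>p\<close> by its peaks and for
  \<open>q\<close> by its valleys, the inversion numbers add up to \<open>n - 1\<close> modulo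
  2.\<close>

lemma perm_sgn_peaks_valleys:
  assumes c: "height_fun n c" "1 \<le> n"
    and "int (card (inversions n p)) = peak_sum n c"
    and "int (card (inversions n q)) = valley_sum n c"
  shows "perm_sgn n p = (if odd n then perm_sgn n q else - perm_sgn n q)"
proof -
  have "even (int (card (inversions n p)) + int (card (inversions n q)) - (int n - 1))"
    using even_peak_sum_plus_valley_sum[OF c] assms(3,4) by simp
  then show ?thesis
    unfolding perm_sgn_def minus_one_power_iff by auto
qed

text \<open>Antiexcedance values increase with position. So taking for \<open>c i\<close> one less
  than the first antiexcedance position with value at least \<open>i\<close> makes \<open>c\<close>
  rise exactly after the antiexcedance values.\<close>

lemma ex_heights_of_antiexcedances:
  assumes p: "p \<in> S321 n"
  obtains c where "height_fun n c" "valley_pairs n c = {(i, p i) | i. i \<in> {1..n} \<and> p i < i}"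
proof -
  have perm: "p permutes {1..n}" using p by (rule S321_permutes)
  define T where "T i = {a \<in> {1..n}. p a < a \<and> i \<le> p a}" for i
  \<comment> \<open>The inserted \<open>n\<close> is the default when no antiexcedance is left; it
    gives \<open>c n = n\<close>.\<close>
  define c where "c i = (if i = 0 then 0 else Min (insert n ((\<lambda>a. a - 1) ` T i)))" for i
  have fin: "finite (insert n ((\<lambda>a. a - 1) ` T i))" for i by (simp add: T_def)
  have le_c: "m \<le> c i \<longleftrightarrow> m \<le> n \<and> (\<forall>a\<in>T i. m \<le> a - 1)" if "i \<noteq> 0" for i m
    using that fin[of i] by (simp add: c_def)
  have c_le: "c i \<le> n" "a \<in> T i \<Longrightarrow> c i \<le> a - 1" if "i \<noteq> 0" for i a
    using le_c[OF that, of "c i"] by auto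
  have height: "height_fun n c"
    unfolding height_fun_def
  proof (intro conjI allI impI)
    show "c 0 = 0" by (simp add: c_def)
    have "T n = {}" by (auto simp: T_def)
    then show "c n = n" by (simp add: c_def)
    fix i
    show "c i \<le> c (Suc i)" if "i < n"
    proof (cases "i = 0")
      case False
      have "T (Suc i) \<subseteq> T i" by (auto simp: T_def)
      then show ?thesis using le_c[of "Suc i" "c i"] c_le[OF False] by auto
    qed (simp add: c_def)
    show "i \<le> c i" if "i \<le> n"
    proof (cases "i = 0")
      case False
      then show ?thesis using that by (auto simp: le_c T_def)
    qed simp
  qed
  have jump: "c (p a) < c (Suc (p a)) \<and> Suc (c (p a)) = a"
    if a: "a \<in> {1..n}" "p a < a" for a
  proof -
    \<comment> \<open>Larger antiexcedance values lie further right, so \<open>a\<close> is the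
      least element of \<open>T (p a)\<close> and drops out of \<open>T (Suc (p a))\<close>.\<close>
    have less: "a < b" if "b \<in> T (Suc (p a))" for b
      using S321_less_of_not_excedance[OF p, of b a] that a
      unfolding T_def by (cases a b rule: linorder_cases) auto
    have "p a \<noteq> 0" using permutes_atLeastAtMost_in[OF perm a(1)] by simp
    have "T (p a) \<subseteq> insert a (T (Suc (p a)))"
      using injD[OF permutes_inj[OF perm]] by (force simp: T_def Suc_le_eq le_less)
    then have "a - 1 \<le> c (p a)"
      using less a le_c[OF \<open>p a \<noteq> 0\<close>] by fastforce
    moreover have "c (p a) \<le> a - 1"
      using c_le(2)[OF \<open>p a \<noteq> 0\<close>, of a] a by (simp add: T_def)
    moreover have "a \<le> c (Suc (p a))"
      using less a le_c[of "Suc (p a)" a] by fastforce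
    ultimately show ?thesis using a by auto
  qed
  have no_jump: "c i = c (Suc i)" if "i \<noteq> 0" "\<not> (\<exists>a\<in>{1..n}. p a < a \<and> p a = i)" for i
  proof -
    have "T i = T (Suc i)" using that(2) by (auto simp: T_def Suc_le_eq le_less)
    then show ?thesis using that(1) by (simp add: c_def)
  qed
  have "valley_pairs n c = {(i, p i) | i. i \<in> {1..n} \<and> p i < i}"
  proof (intro equalityI subsetI)
    fix x assume "x \<in> valley_pairs n c"
    then obtain i where i: "x = (Suc (c i), i)" "i \<in> {1..<n}" "c i < c (Suc i)"
      unfolding valley_pairs_def by blast
    then have "\<exists>a\<in>{1..n}. p a < a \<and> p a = i"
      using no_jump[of i] by (metis atLeastLessThan_iff less_irrefl not_one_le_zero)
    then obtain a where "a \<in> {1..n}" "p a < a" "p a = i"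
      by blast
    then show "x \<in> {(i, p i) | i. i \<in> {1..n} \<and> p i < i}"
      using i(1) jump[of a] by auto
  next
    fix x assume "x \<in> {(i, p i) | i. i \<in> {1..n} \<and> p i < i}"
    then obtain a where a: "x = (a, p a)" "a \<in> {1..n}" "p a < a" by blast
    then have "x = (Suc (c (p a)), p a) \<and> p a \<in> {1..<n} \<and> c (p a) < c (Suc (p a))"
      using jump[of a] permutes_atLeastAtMost_in[OF perm a(2)] by simp
    then show "x \<in> valley_pairs n c" unfolding valley_pairs_def by blast
  qed
  with height show thesis by (rule that)
qed

text \<open>A path whose peaks off the cells \<open>(i, i)\<close> are the transposed valleys of
  \<open>c\<close>. Elsewhere the height is kept unless the Dyck condition forces it up to the
  index, which adds only a peak at a cell \<open>(i, i)\<close>, a future fixed point.\<close>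

primrec shifted_heights :: "nat \<Rightarrow> (nat \<Rightarrow> nat) \<Rightarrow> nat \<Rightarrow> nat" where
  "shifted_heights n c 0 = 0"
| "shifted_heights n c (Suc i) = max (Suc i)
     (if Suc i < n \<and> c (Suc i) < c (Suc (Suc i)) then Suc (c (Suc i)) else shifted_heights n c i)"

text \<open>Ensures that each valley of \<open>c\<close> produces a genuine ascent, and that the
  last height is \<open>n\<close>.\<close>

lemma shifted_heights_le:
  assumes c: "height_fun n c"
  shows "i < n \<Longrightarrow> shifted_heights n c i \<le> c (Suc i)"
proof (induction i)
  case (Suc i)
  then have "c (Suc i) \<le> c (Suc (Suc i))" "Suc (Suc i) \<le> c (Suc (Suc i))"
    using c by (auto simp: height_fun_def)
  then show ?case using Suc by auto
qed simp

lemma shifted_heights_ge: "i \<le> shifted_heights n c i"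
  by (cases i) auto

lemma height_fun_shifted_heights:
  assumes c: "height_fun n c"
  shows "height_fun n (shifted_heights n c)"
  unfolding height_fun_def
proof (intro conjI allI impI)
  show "shifted_heights n c n = n"
  proof (cases n)
    case (Suc m)
    then have "shifted_heights n c m \<le> n"
      using shifted_heights_le[OF c, of m] c by (simp add: height_fun_def)
    then show ?thesis using Suc by simp
  qed simp
  fix i
  show "shifted_heights n c i \<le> shifted_heights n c (Suc i)" if "i < n"
    using shifted_heights_le[OF c that] by auto
qed (simp_all add: shifted_heights_ge)

text \<open>At a valley of \<open>c\<close> the height climbs from at most \<open>c i\<close> to
  \<open>Suc (c i)\<close>, above \<open>i\<close>; elsewhere it stays or becomes
  \<open>i\<close>.\<close>

lemma peak_shifted_heights_iff:
  assumes c: "height_fun n c" and i: "i \<in> {1..n}"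
  shows "shifted_heights n c (i - 1) < shifted_heights n c i \<and> i < shifted_heights n c i \<longleftrightarrow>
    i < n \<and> c i < c (Suc i)"
    and "i < n \<and> c i < c (Suc i) \<longrightarrow> shifted_heights n c i = Suc (c i)"
proof -
  obtain k where k: "i = Suc k" using i by (cases i) auto
  have "shifted_heights n c k \<le> c i" "i \<le> c i"
    using shifted_heights_le[OF c, of k] height_fun_ge[OF c, of i] i k by auto
  then show "shifted_heights n c (i - 1) < shifted_heights n c i \<and> i < shifted_heights n c i \<longleftrightarrow>
    i < n \<and> c i < c (Suc i)"
    "i < n \<and> c i < c (Suc i) \<longrightarrow> shifted_heights n c i = Suc (c i)"
    using k by auto
qed

text \<open>Realize the shifted path by its weak excedances; the peaks at cells
  \<open>(i, i)\<close> become fixed points.\<close>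

lemma ex_S321_of_valleys:
  assumes c: "height_fun n c"
  obtains q where "q \<in> S321 n" "{(q i, i) | i. i \<in> {1..n} \<and> q i > i} = valley_pairs n c"
proof -
  let ?d = "shifted_heights n c"
  obtain q where q: "q \<in> S321 n" "{(i, q i) | i. i \<in> {1..n} \<and> q i \<ge> i} = peak_pairs n ?d"
    using ex_S321_of_heights[OF height_fun_shifted_heights[OF c]] by blast
  have "(j, i) \<in> {(q i, i) | i. i \<in> {1..n} \<and> q i > i} \<longleftrightarrow> (j, i) \<in> valley_pairs n c" for i j
  proof -
    have "(j, i) \<in> {(q i, i) | i. i \<in> {1..n} \<and> q i > i} \<longleftrightarrow>
        (i, j) \<in> {(i, q i) | i. i \<in> {1..n} \<and> q i \<ge> i} \<and> i < j" by auto
    also have "\<dots> \<longleftrightarrow> i \<in> {1..n} \<and> ?d (i - 1) < ?d i \<and> i < ?d i \<and> j = ?d i"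
      unfolding q(2) peak_pairs_def by auto
    also have "\<dots> \<longleftrightarrow> i \<in> {1..n} \<and> i < n \<and> c i < c (Suc i) \<and> j = Suc (c i)"
      using peak_shifted_heights_iff[OF c, of i] by metis
    also have "\<dots> \<longleftrightarrow> (j, i) \<in> valley_pairs n c"
      unfolding valley_pairs_def by auto
    finally show ?thesis .
  qed
  then have "{(q i, i) | i. i \<in> {1..n} \<and> q i > i} = valley_pairs n c"
    by (intro set_eqI) (simp only: split_paired_all)
  with q(1) show thesis by (rule that)
qed

section \<open>Rowmotion and the Lalanne--Kreweras involution\<close>

text \<open>\<open>{i..j}\<close> lies in some \<open>{h..p h - 1}\<close> exactly when some
  \<open>h \<le> i\<close> has \<open>p h > j\<close>, which the prefix maximum at \<open>i\<close>
  decides.\<close>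

lemma complement_order_ideal_Exc:
  assumes p: "p permutes {1..n}"
  shows "interval_poset (n - 1) - order_ideal_gen (interval_poset (n - 1)) (Exc n p) =
    {{i..j} | i j. 1 \<le> i \<and> i \<le> j \<and> j < n \<and> height_of p i \<le> j}"
proof -
  have ideal: "(\<exists>a\<in>Exc n p. {i..j} \<le> a) \<longleftrightarrow> j < height_of p i"
    if ij: "1 \<le> i" "i \<le> j" "j < n" for i j
  proof
    assume "\<exists>a\<in>Exc n p. {i..j} \<le> a"
    then obtain h where h: "h \<in> {1..n}" "h < p h" "{i..j} \<le> {h..p h - 1}"
      unfolding Exc_def by auto
    then have "h \<le> i" "j < p h" using ij by (auto simp: atLeastatMost_subset_iff)
    moreover have "p h \<le> height_of p i" using le_height_of[of h i p] h(1) \<open>h \<le> i\<close> by simp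
    ultimately show "j < height_of p i" by simp
  next
    assume "j < height_of p i"
    then obtain h where h: "h \<in> {1..i}" "j < p h"
      using height_of_attained[OF ij(1), of p] by auto
    then have "{i..j} \<le> {h..p h - 1}" "{h..p h - 1} \<in> Exc n p"
      using ij by (auto simp: Exc_def)
    then show "\<exists>a\<in>Exc n p. {i..j} \<le> a" by blast
  qed
  show ?thesis
  proof (intro equalityI subsetI)
    fix x assume x: "x \<in> interval_poset (n - 1) - order_ideal_gen (interval_poset (n - 1)) (Exc n p)"
    then obtain i j where ij: "x = {i..j}" "1 \<le> i" "i \<le> j" "j \<le> n - 1"
      unfolding interval_poset_def by blast
    then have "j < n" by simp
    then show "x \<in> {{i..j} | i j. 1 \<le> i \<and> i \<le> j \<and> j < n \<and> height_of p i \<le> j}"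
      using x ij ideal[of i j] unfolding order_ideal_gen_def by force
  next
    fix x assume "x \<in> {{i..j} | i j. 1 \<le> i \<and> i \<le> j \<and> j < n \<and> height_of p i \<le> j}"
    then obtain i j where ij: "x = {i..j}" "1 \<le> i" "i \<le> j" "j < n" "height_of p i \<le> j" by blast
    then have "x \<in> interval_poset (n - 1)" unfolding interval_poset_def by fastforce
    then show "x \<in> interval_poset (n - 1) - order_ideal_gen (interval_poset (n - 1)) (Exc n p)"
      using ij ideal[of i j] unfolding order_ideal_gen_def by simp
  qed
qed

text \<open>A minimal interval cannot be shortened on the right, so \<open>j = c i\<close>, nor on
  the left, so \<open>c\<close> rises after \<open>i\<close>. Conversely, after such a rise an
  interval starting beyond \<open>i\<close> must reach beyond \<open>c i\<close>.\<close>

lemma minimal_elements_staircase: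
  assumes c: "height_fun n c"
  shows "minimal_elements {{i..j} | i j. 1 \<le> i \<and> i \<le> j \<and> j < n \<and> c i \<le> j} =
    {{i..c i} | i. i \<in> {1..<n} \<and> c i < c (Suc i)}" (is "minimal_elements ?C = ?M")
proof (intro equalityI subsetI)
  fix x assume "x \<in> minimal_elements ?C"
  then have x: "x \<in> ?C" and min: "\<And>y. y \<in> ?C \<Longrightarrow> \<not> y < x"
    unfolding minimal_elements_def by blast+
  obtain i j where ij: "x = {i..j}" "1 \<le> i" "i \<le> j" "j < n" "c i \<le> j"
    using x by blast
  have ci: "i \<le> c i" "Suc i \<le> c (Suc i)" using height_fun_ge[OF c] ij by simp_all
  have "j = c i"
  proof (rule ccontr)
    assume "j \<noteq> c i"
    then have "{i..j - 1} \<in> ?C" using ij ci by fastforce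
    moreover have "{i..j - 1} < x" using ij(1-3) ci \<open>j \<noteq> c i\<close> ij(5) by auto
    ultimately show False using min by blast
  qed
  moreover have "c i < c (Suc i)"
  proof (rule ccontr)
    assume "\<not> c i < c (Suc i)"
    then have "{Suc i..j} \<in> ?C" using ij ci \<open>j = c i\<close> by fastforce
    moreover have "{Suc i..j} < x" using ij(1-3) by auto
    ultimately show False using min by blast
  qed
  ultimately show "x \<in> ?M" using ij by auto
next
  fix x assume "x \<in> ?M"
  then obtain i where i: "x = {i..c i}" "i \<in> {1..<n}" "c i < c (Suc i)" by blast
  have "i \<le> c i" "c (Suc i) \<le> n"
    using height_fun_ge[OF c, of i] height_fun_le[OF c, of "Suc i"] i(2) by simp_all
  then have "1 \<le> i \<and> i \<le> c i \<and> c i < n \<and> c i \<le> c i" using i by simp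
  then have "x \<in> ?C" using i(1) by blast
  moreover have "\<not> y < x" if "y \<in> ?C" for y
  proof
    assume "y < x"
    obtain h j where h: "y = {h..j}" "1 \<le> h" "h \<le> j" "j < n" "c h \<le> j" using \<open>y \<in> ?C\<close> by blast
    have "i \<le> h" "j \<le> c i" using \<open>y < x\<close> h(1,3) i(1) by auto
    then have "\<not> Suc i \<le> h"
      using height_fun_mono[OF c, of "Suc i" h] h i(3) by auto
    then have "h = i" using \<open>i \<le> h\<close> by simp
    then show False using \<open>y < x\<close> h(1,5) i(1) \<open>j \<le> c i\<close> by simp
  qed
  ultimately show "x \<in> minimal_elements ?C" unfolding minimal_elements_def by blast
qed

text \<open>The minimal interval \<open>{i..c i}\<close> is \<open>{i..q i - 1}\<close> with
  \<open>q i = Suc (c i)\<close>, the column of the valley in row \<open>i\<close>. The explicit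
  preimage \<open>q\<close> evaluates the inverse of \<open>Exc\<close>.\<close>

lemma rho_S_excedances:
  assumes p: "p \<in> S321 n"
  shows "rho_S n p \<in> S321 n"
    and "{(rho_S n p i, i) | i. i \<in> {1..n} \<and> rho_S n p i > i} = valley_pairs n (height_of p)"
proof -
  have perm: "p permutes {1..n}" using p by (rule S321_permutes)
  let ?c = "height_of p"
  have c: "height_fun n ?c" using perm by (rule height_fun_height_of)
  obtain q where q: "q \<in> S321 n" "{(q i, i) | i. i \<in> {1..n} \<and> q i > i} = valley_pairs n ?c"
    using ex_S321_of_valleys[OF c] by blast
  have "Exc n q = (\<lambda>(j, i). {i..j - 1}) ` {(q i, i) | i. i \<in> {1..n} \<and> q i > i}"
    unfolding Exc_def by auto
  also have "\<dots> = {{i..?c i} | i. i \<in> {1..<n} \<and> ?c i < ?c (Suc i)}"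
    unfolding q(2) valley_pairs_def by force
  also have "\<dots> = antichain_rowmotion (interval_poset (n - 1)) (Exc n p)"
    unfolding antichain_rowmotion_def complement_order_ideal_Exc[OF perm]
      minimal_elements_staircase[OF c] ..
  finally have "antichain_rowmotion (interval_poset (n - 1)) (Exc n p) = Exc n q" ..
  then have "rho_S n p = q"
    unfolding rho_S_def using the_inv_into_f_f[OF inj_on_Exc q(1)] by simp
  with q show "rho_S n p \<in> S321 n"
    "{(rho_S n p i, i) | i. i \<in> {1..n} \<and> rho_S n p i > i} = valley_pairs n ?c" by simp_all
qed

lemma E_p_S321: "p \<in> S321 n \<Longrightarrow> E_p n p = height_word (height_of p) n"
  by (intro E_p_eqI height_fun_height_of peak_pairs_height_of S321_permutes)

lemma inj_on_E_p: "inj_on (E_p n) (S321 n)"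
proof (rule inj_onI)
  fix p q assume p: "p \<in> S321 n" and q: "q \<in> S321 n" and "E_p n p = E_p n q"
  then have "peak_cells_above (height_word (height_of p) n) =
      peak_cells_above (height_word (height_of q) n)"
    by (simp add: E_p_S321)
  then have "peak_pairs n (height_of p) = peak_pairs n (height_of q)"
    by (simp only: height_word_peak_cells[OF height_fun_height_of[OF S321_permutes[OF p]]]
        height_word_peak_cells[OF height_fun_height_of[OF S321_permutes[OF q]]])
  then show "p = q"
    using S321_eqI[OF p q weak_excedances_eq_imp_excedances_eq]
    by (simp add: peak_pairs_height_of p q)
qed

text \<open>The word \<open>height_word c n\<close> is both \<open>D_v n p\<close> and
  \<open>E_p n q\<close>, so \<open>q\<close> is the image.\<close>

lemma LK_S_excedances:
  assumes p: "p \<in> S321 n" and c: "height_fun n c"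
    and valleys: "valley_pairs n c = {(i, p i) | i. i \<in> {1..n} \<and> p i < i}"
  shows "LK_S n p \<in> S321 n"
    and "{(i, LK_S n p i) | i. i \<in> {1..n} \<and> LK_S n p i \<ge> i} = peak_pairs n c"
proof -
  obtain q where q: "q \<in> S321 n" "{(i, q i) | i. i \<in> {1..n} \<and> q i \<ge> i} = peak_pairs n c"
    using ex_S321_of_heights[OF c] by blast
  have "LK n (E_p n p) = D_v n p"
    unfolding LK_def using the_inv_into_f_f[OF inj_on_E_p p] by simp
  also have "\<dots> = E_p n q"
    using D_v_eqI[OF c valleys] E_p_eqI[OF c q(2)[symmetric]] by simp
  finally have "LK_S n p = q"
    unfolding LK_S_def using the_inv_into_f_f[OF inj_on_E_p q(1)] by simp
  with q show "LK_S n p \<in> S321 n"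
    "{(i, LK_S n p i) | i. i \<in> {1..n} \<and> LK_S n p i \<ge> i} = peak_pairs n c" by simp_all
qed

theorem theorem4p5:
  fixes n :: nat and \<pi> :: "nat \<Rightarrow> nat"
  assumes "n \<ge> 1" and "\<pi> \<in> S321 n"
  shows "perm_sgn n (rho_S n \<pi>) = perm_sgn n (LK_S n \<pi>) \<and>
         perm_sgn n (LK_S n \<pi>) = (if odd n then perm_sgn n \<pi> else - perm_sgn n \<pi>)"
proof -
  have perm: "\<pi> permutes {1..n}" using assms(2) by (rule S321_permutes)
  obtain c where c: "height_fun n c" "valley_pairs n c = {(i, \<pi> i) | i. i \<in> {1..n} \<and> \<pi> i < i}"
    using ex_heights_of_antiexcedances[OF assms(2)] by blast
  have "perm_sgn n (LK_S n \<pi>) = (if odd n then perm_sgn n \<pi> else - perm_sgn n \<pi>)"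
    using perm_sgn_peaks_valleys[OF c(1) assms(1)]
      card_inversions_eq_peak_sum[OF LK_S_excedances[OF assms(2) c]]
      card_inversions_eq_valley_sum_antiexcedances[OF assms(2) c(2)[symmetric]] by blast
  \<comment> \<open>The roles are exchanged: \<open>\<pi>\<close> now supplies the peaks and its
    image the valleys. The sign rule is its own inverse, so it can be solved for the image.\<close>
  moreover have "perm_sgn n \<pi> = (if odd n then perm_sgn n (rho_S n \<pi>) else - perm_sgn n (rho_S n \<pi>))"
    using perm_sgn_peaks_valleys[OF height_fun_height_of[OF perm] assms(1)]
      card_inversions_eq_peak_sum[OF assms(2) peak_pairs_height_of[OF assms(2), symmetric]]
      card_inversions_eq_valley_sum_excedances[OF rho_S_excedances[OF assms(2)]] by blast
  ultimately show ?thesis by (simp split: if_splits)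
qed

end
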